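(* Let $X$ be a (real) Hilbert space, let $Y$ be a real vector space and let $a:X\times Y\to\mathbb{R}\cup\{+\infty\}$. Assume that for every $y\in Y$ the function $a(\cdot,y):X\to\mathbb{R}\cup\{+\infty\}$ is proper $\Phi_{lsc}$-convex on $X$. If $\sup_{y\in Y}\inf_{x\in X}a(x,y)=\inf_{x\in X}\sup_{y\in Y}a(x,y)$, then for every $\alpha\in\mathbb{R}$ with $\alpha<\inf_{x\in X}\sup_{y\in Y}a(x,y)$ and every bounded set $Z\subset X$ there exist $y_1,y_2\in Y$, $x_1\in\operatorname{dom}(a(\cdot,y_1))$, $x_2\in\operatorname{dom}(a(\cdot,y_2))$, $\varphi_1\in\partial_{\Phi_{lsc}}a(\cdot,y_1)(x_1)$ and $\varphi_2\in\partial_{\Phi_{lsc}}a(\cdot,y_2)(x_2)$ such that the intersection property holds for $\varphi_1$ and $\varphi_2$ on $Z$ at the level $\alpha$.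
   Context: $\Phi_{lsc}$ is the class of functions $\varphi:X\to\mathbb{R}$ of the form $\varphi(x)=-a\|x\|^2+\langle\ell,x\rangle+c$ with $a\ge0$, $\ell\in X^*$, $c\in\mathbb{R}$. For $f:X\to\mathbb{R}\cup\{+\infty\}$: $\operatorname{dom}(f):=\{x\in X:f(x)<+\infty\}$; $f$ is proper if $\operatorname{dom}(f)\ne\emptyset$; $\operatorname{supp}(f):=\{\varphi\in\Phi_{lsc}:\varphi(x)\le f(x)\ \forall x\in X\}$; $f$ is $\Phi_{lsc}$-convex if $\operatorname{supp}(f)\neq\emptyset$ and $f(x)=\sup\{\varphi(x):\varphi\in\operatorname{supp}(f)\}$ for all $x\in X$. For $\bar x\in\operatorname{dom}(f)$, the $\Phi_{lsc}$-subdifferential is $\partial_{\Phi_{lsc}}f(\bar x):=\{\varphi\in\operatorname{supp}(f):\ \varphi(\bar x)=f(\bar x)\}$. For a set $Z\subset X$ and $\alpha\in\mathbb{R}$, functions $\varphi_1,\varphi_2:X\to\mathbb{R}$ have the intersection property on $Z$ at the level $\alpha$ if there is no $x\in Z$ with both $\varphi_1(x)<\alpha$ and $\varphi_2(x)<\alpha$. *)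

theory Defs
  imports "HOL-Analysis.Analysis"
begin

text \<open>
  A real Hilbert space is a type of sort \<open>{real_inner, complete_space}\<close>.  Functions with values in
  \<open>\<real> \<union> {+\<infinity>}\<close> are \<open>ereal\<close>-valued functions; that they avoid \<open>-\<infinity>\<close> is to be
  assumed separately, as it is not built into the definitions below.
\<close>

definition Phi_lsc :: "('x::real_inner \<Rightarrow> real) set" where
  "Phi_lsc = {\<phi>. \<exists>a l c. a \<ge> 0 \<and> bounded_linear l \<and>
                 \<phi> = (\<lambda>x. - a * (norm x)\<^sup>2 + l x + c)}"

definition eff_dom :: "('x \<Rightarrow> ereal) \<Rightarrow> 'x set" where
  "eff_dom f = {x. f x < \<infinity>}"

definition proper_fun :: "('x \<Rightarrow> ereal) \<Rightarrow> bool" where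
  "proper_fun f \<longleftrightarrow> eff_dom f \<noteq> {}"

definition supp_lsc :: "('x::real_inner \<Rightarrow> ereal) \<Rightarrow> ('x \<Rightarrow> real) set" where
  "supp_lsc f = {\<phi> \<in> Phi_lsc. \<forall>x. ereal (\<phi> x) \<le> f x}"

definition Phi_lsc_convex :: "('x::real_inner \<Rightarrow> ereal) \<Rightarrow> bool" where
  "Phi_lsc_convex f \<longleftrightarrow>
     supp_lsc f \<noteq> {} \<and> (\<forall>x. f x = (SUP \<phi>\<in>supp_lsc f. ereal (\<phi> x)))"

text \<open>The subdifferential is only meaningful at points of the effective domain; at any other point
  this definition yields the empty set.\<close>

definition subdiff_lsc :: "('x::real_inner \<Rightarrow> ereal) \<Rightarrow> 'x \<Rightarrow> ('x \<Rightarrow> real) set" where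
  "subdiff_lsc f x = {\<phi> \<in> supp_lsc f. ereal (\<phi> x) = f x}"

definition intersection_property ::
    "('x \<Rightarrow> real) \<Rightarrow> ('x \<Rightarrow> real) \<Rightarrow> 'x set \<Rightarrow> real \<Rightarrow> bool" where
  "intersection_property \<phi>1 \<phi>2 Z \<alpha> \<longleftrightarrow> \<not> (\<exists>x\<in>Z. \<phi>1 x < \<alpha> \<and> \<phi>2 x < \<alpha>)"

end

theory Submission
  imports Defs "HOL-Real_Asymp.Real_Asymp"
begin

text \<open>
  One function \<open>\<phi>\<close> does the work of both \<open>\<phi>1\<close> and \<open>\<phi>2\<close>.  The minimax equality provides a single
  \<open>y\<close> with \<open>\<alpha> < b \<le> a x y\<close> for all \<open>x\<close>, and it then suffices to find a \<open>\<Phi>\<close>-subgradient of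
  \<open>f = a(\<cdot>, y)\<close> that is at least \<open>\<alpha>\<close> on the whole of \<open>Z\<close>: the intersection property then holds
  trivially for the pair \<open>\<phi>, \<phi>\<close>.

  A constant function below \<open>f\<close> need not touch \<open>f\<close> anywhere, as \<open>f\<close> need not attain its infimum.
  The remedy is a smooth variational principle in the manner of Borwein and Preiss
  (\<open>tilted_minimum_exists\<close>): for every \<open>e > 0\<close> there are a coefficient \<open>c\<close> between \<open>e\<close> and \<open>2e\<close> and
  a vector \<open>v\<close> of norm at most \<open>e\<close> such that \<open>f x + c \<parallel>x\<parallel>\<^sup>2 - 2 \<langle>v, x\<rangle>\<close> attains its minimum, at
  \<open>p\<close> say.  Moving the perturbation to the other side says exactly that
  \<open>\<phi> x = - c \<parallel>x\<parallel>\<^sup>2 + 2 \<langle>v, x\<rangle> + const\<close> lies below \<open>f\<close> and touches it at \<open>p\<close>.  On a ball of radius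
  \<open>R\<close> this \<open>\<phi>\<close> is at least \<open>b - 2 e (1 + R)\<^sup>2\<close>, which is at least \<open>\<alpha>\<close> once \<open>e\<close> is small.

  The variational principle rests on the fact that in an inner product space a sum of terms
  \<open>m\<^sub>i \<parallel>x - x\<^sub>i\<parallel>\<^sup>2\<close> is, up to a constant, again of the form \<open>c \<parallel>x\<parallel>\<^sup>2 - 2 \<langle>v, x\<rangle>\<close>.  Adding a small
  multiple of \<open>\<parallel>x - x\<^sub>i\<parallel>\<^sup>2\<close>, with \<open>x\<^sub>i\<close> a sufficiently good approximate minimiser, forces all better
  approximate minimisers to be close to \<open>x\<^sub>i\<close> (\<open>shrink_near_min\<close>).  Iterating gives a nested
  sequence of closed sets with diameters tending to zero, and their common point is the minimiser
  for the limit perturbation.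
\<close>

section \<open>Approximate minimisers of quadratically tilted functions\<close>

definition tilt :: "('x::real_inner \<Rightarrow> real) \<Rightarrow> real \<Rightarrow> 'x \<Rightarrow> 'x \<Rightarrow> real" where
  "tilt g c v x = g x + c * (norm x)\<^sup>2 - 2 * (v \<bullet> x)"

text \<open>
  Restricting to a set \<open>D\<close>, in the application the effective domain, allows real-valued functions in
  place of extended ones.
\<close>

definition near_min :: "'x set \<Rightarrow> ('x \<Rightarrow> real) \<Rightarrow> real \<Rightarrow> 'x set" where
  "near_min D h t = {x \<in> D. \<forall>y\<in>D. h x \<le> h y + t}"

lemma near_min_nonempty:
  assumes "D \<noteq> {}" and bound: "\<forall>x\<in>D. b \<le> h x" and "t > 0"
  shows "near_min D h t \<noteq> {}"
proof -
  have bdd: "bdd_below (h ` D)" using bound by (intro bdd_belowI[of _ b]) blast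
  have "Inf (h ` D) < Inf (h ` D) + t" using \<open>t > 0\<close> by simp
  then obtain x where "x \<in> D" "h x < Inf (h ` D) + t"
    using cInf_lessD[of "h ` D"] \<open>D \<noteq> {}\<close> by blast
  moreover have "Inf (h ` D) \<le> h y" if "y \<in> D" for y
    using bdd that by (auto intro: cInf_lower)
  ultimately have "h x \<le> h y + t" if "y \<in> D" for y
    using that by (meson add_right_mono less_le_trans less_imp_le)
  with \<open>x \<in> D\<close> show ?thesis by (auto simp: near_min_def)
qed

text \<open>Completing the square: the tilt alone is bounded below by \<open>- \<parallel>v\<parallel>\<^sup>2 / c\<close>.\<close>

lemma tilt_lower_bound:
  assumes "b \<le> g x" "c > 0"
  shows "b - (norm v)\<^sup>2 / c \<le> tilt g c v x"
proof -
  have "v \<bullet> x \<le> norm v * norm x" by (rule norm_cauchy_schwarz)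
  moreover have "0 \<le> (c * norm x - norm v)\<^sup>2 / c" using \<open>c > 0\<close> by simp
  moreover have "(c * norm x - norm v)\<^sup>2 / c
      = c * (norm x)\<^sup>2 - 2 * (norm v * norm x) + (norm v)\<^sup>2 / c"
    using \<open>c > 0\<close> by (simp add: power2_eq_square field_simps)
  ultimately show ?thesis using assms by (simp add: tilt_def)
qed

text \<open>
  The quadratic term makes the tilted function coercive.  This bounds the approximate minimisers
  before one of them is chosen, so that the weight of the next quadratic term can be fixed first.
\<close>

lemma bounded_near_min_tilt:
  assumes "c > 0" and bound: "\<forall>x\<in>D. b \<le> g x"
  shows "bounded (near_min D (tilt g c v) t)"
proof (cases "D = {}")
  case True
  then show ?thesis by (simp add: near_min_def)
next
  case False
  then obtain p where "p \<in> D" by auto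
  define L where "L = \<bar>tilt g c v p + t - b\<bar>"
  have "norm x \<le> 1 + (L + 2 * norm v) / c" if x: "x \<in> near_min D (tilt g c v) t" for x
  proof (cases "norm x \<le> 1")
    case True
    moreover have "0 \<le> (L + 2 * norm v) / c" using \<open>c > 0\<close> by (simp add: L_def)
    ultimately show ?thesis by simp
  next
    case False
    have "tilt g c v x \<le> tilt g c v p + t" and "b \<le> g x"
      using x \<open>p \<in> D\<close> bound by (auto simp: near_min_def)
    moreover have "v \<bullet> x \<le> norm v * norm x" by (rule norm_cauchy_schwarz)
    ultimately have "c * (norm x)\<^sup>2 \<le> L * 1 + 2 * norm v * norm x"
      by (simp add: tilt_def L_def)
    \<comment> \<open>As \<open>norm x > 1\<close>, every term carries a factor \<open>norm x\<close>, which can then be cancelled.\<close>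
    also have "\<dots> \<le> L * norm x + 2 * norm v * norm x"
      using False by (intro add_right_mono mult_left_mono) (auto simp: L_def)
    finally have "(c * norm x) * norm x \<le> (L + 2 * norm v) * norm x"
      by (simp add: power2_eq_square algebra_simps)
    then have "c * norm x \<le> L + 2 * norm v" using False by (auto simp: mult_le_cancel_right)
    then show ?thesis using \<open>c > 0\<close> by (simp add: field_simps)
  qed
  then show ?thesis by (auto simp: bounded_iff)
qed

text \<open>
  Lower semicontinuity of \<open>g\<close> on \<open>D\<close>, extended by \<open>+\<infinity>\<close>, enters as closedness of the epigraph.  Each
  condition \<open>tilt g c v x \<le> tilt g c v y + t\<close> bounds \<open>g x\<close> by a continuous function of \<open>x\<close>, hence
  describes a preimage of the epigraph under a continuous map.
\<close>

lemma closed_near_min_tilt: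
  assumes epi: "closed {(x, r). x \<in> D \<and> g x \<le> r}" and "D \<noteq> {}"
  shows "closed (near_min D (tilt g c v) t)"
proof -
  let ?r = "\<lambda>y x. tilt g c v y + t - c * (norm x)\<^sup>2 + 2 * (v \<bullet> x)"
  have "near_min D (tilt g c v) t
      = (\<Inter>y\<in>D. (\<lambda>x. (x, ?r y x)) -` {(x, r). x \<in> D \<and> g x \<le> r})"
    using \<open>D \<noteq> {}\<close> by (auto simp: near_min_def tilt_def algebra_simps)
  moreover have "closed ((\<lambda>x. (x, ?r y x)) -` {(x, r). x \<in> D \<and> g x \<le> r})" for y
    by (intro closed_vimage[OF epi] continuous_intros)
  ultimately show ?thesis by auto
qed

text \<open>
  Penalising the distance to a point stays within the two-parameter family of tilts, up to a
  constant that does not influence minimisers.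
\<close>

lemma tilt_add_quadratic:
  "tilt g (c + m) (v + m *\<^sub>R p) x = tilt g c v x + m * (dist x p)\<^sup>2 - m * (norm p)\<^sup>2"
proof -
  have "(dist x p)\<^sup>2 = (norm x)\<^sup>2 - 2 * (p \<bullet> x) + (norm p)\<^sup>2"
    unfolding dist_norm power2_norm_eq_inner inner_diff_left inner_diff_right
    by (simp add: inner_commute[of x p])
  then show ?thesis by (simp add: tilt_def inner_add_left) (simp add: algebra_simps)
qed

text \<open>
  Add \<open>m \<parallel>x - p\<parallel>\<^sup>2\<close> for an \<open>s\<close>-minimiser \<open>p\<close>.  An \<open>s\<close>-minimiser \<open>x\<close> of the new function is no worse
  than \<open>p\<close> up to \<open>s\<close>, so it is a \<open>2s\<close>-minimiser of the old function and satisfies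
  \<open>m \<parallel>x - p\<parallel>\<^sup>2 \<le> 2 s\<close>.  With \<open>s\<close> small compared to \<open>m\<close> this localises \<open>x\<close> near \<open>p\<close>.
\<close>

lemma shrink_near_min:
  assumes "D \<noteq> {}" and bound: "\<forall>x\<in>D. b \<le> g x"
    and "c > 0" "t > 0" "d > 0"
  obtains c' v' t' where "c \<le> c'" "dist c c' \<le> d" "dist v v' \<le> d" "0 < t'" "t' \<le> d"
    and "near_min D (tilt g c' v') t' \<subseteq> near_min D (tilt g c v) t"
    and "\<forall>x\<in>near_min D (tilt g c' v') t'. \<forall>y\<in>near_min D (tilt g c' v') t'. dist x y \<le> d"
proof -
  obtain M where M: "M > 0" "\<And>x. x \<in> near_min D (tilt g c v) t \<Longrightarrow> norm x \<le> M"
    using bounded_near_min_tilt[of c D b g v t, OF \<open>c > 0\<close> bound] unfolding bounded_pos by blast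
  \<comment> \<open>\<open>m\<close> controls the change \<open>m\<close> of \<open>c\<close> and the change \<open>m *\<^sub>R p\<close> of \<open>v\<close>; the bounds on \<open>s\<close> serve
      inclusion in the old set, the smallness of \<open>t'\<close>, and radius \<open>d / 2\<close> around \<open>p\<close>.\<close>
  define m where "m = d / (1 + M)"
  define s where "s = min (t / 2) (min d (m * (d / 2)\<^sup>2 / 2))"
  have m: "m > 0" "m \<le> d" "m * M \<le> d"
    using \<open>d > 0\<close> \<open>M > 0\<close> by (auto simp: m_def field_simps)
  have s: "s > 0" "2 * s \<le> t" "s \<le> d" "2 * s \<le> m * (d / 2)\<^sup>2"
    using \<open>t > 0\<close> \<open>d > 0\<close> \<open>m > 0\<close> by (auto simp: s_def min_def)
  have "near_min D (tilt g c v) s \<noteq> {}"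
    using bound \<open>c > 0\<close> \<open>D \<noteq> {}\<close> \<open>s > 0\<close>
    by (intro near_min_nonempty[where b = "b - (norm v)\<^sup>2 / c"] ballI tilt_lower_bound) auto
  then obtain p where p: "p \<in> D" "\<And>y. y \<in> D \<Longrightarrow> tilt g c v p \<le> tilt g c v y + s"
    by (auto simp: near_min_def)
  have "p \<in> near_min D (tilt g c v) t"
    using p s by (force simp: near_min_def)
  then have "norm p \<le> M" by (rule M)
  let ?N = "near_min D (tilt g (c + m) (v + m *\<^sub>R p)) s"
  have key: "tilt g c v x + m * (dist x p)\<^sup>2 \<le> tilt g c v y + 2 * s"
    if x: "x \<in> ?N" and y: "y \<in> D" for x y
  proof -
    have "tilt g c v x + m * (dist x p)\<^sup>2 \<le> tilt g c v p + s"
      using x p(1) unfolding near_min_def tilt_add_quadratic by force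
    also have "\<dots> \<le> tilt g c v y + 2 * s" using p(2)[OF y] by simp
    finally show ?thesis .
  qed
  have near: "dist x p \<le> d / 2" if "x \<in> ?N" for x
  proof -
    have "m * (dist x p)\<^sup>2 \<le> m * (d / 2)\<^sup>2"
      using key[OF that, of x] that s(4) by (simp add: near_min_def)
    then show ?thesis using \<open>m > 0\<close> \<open>d > 0\<close> by (simp add: power2_le_iff_abs_le)
  qed
  show thesis
  proof (rule that[of "c + m" "v + m *\<^sub>R p" s])
    show "dist v (v + m *\<^sub>R p) \<le> d"
      using m \<open>norm p \<le> M\<close> by (simp add: dist_norm) (meson mult_left_mono order_trans less_imp_le)
    show "?N \<subseteq> near_min D (tilt g c v) t"
    proof
      fix x assume x: "x \<in> ?N"
      have "tilt g c v x \<le> tilt g c v y + t" if "y \<in> D" for y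
        using key[OF x that] s m by (smt (verit) mult_nonneg_nonneg zero_le_power2)
      then show "x \<in> near_min D (tilt g c v) t" using x by (simp add: near_min_def)
    qed
    show "\<forall>x\<in>?N. \<forall>y\<in>?N. dist x y \<le> d"
      using near dist_triangle2 by (smt (verit) field_sum_of_halves)
    show "c \<le> c + m" "dist c (c + m) \<le> d" "0 < s" "s \<le> d"
      using m(1,2) s(1,3) by (simp_all add: dist_real_def)
  qed
qed

section \<open>The smooth variational principle\<close>

lemma geometric_steps_converge:
  fixes u :: "nat \<Rightarrow> 'a::complete_space"
  assumes step: "\<And>n. dist (u n) (u (Suc n)) \<le> e / 2 ^ Suc n" and "e > 0"
  obtains l where "u \<longlonglongrightarrow> l" "dist (u 0) l \<le> e"
proof -
  have tele: "dist (u n) (u (n + k)) \<le> e / 2 ^ n - e / 2 ^ (n + k)" for n k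
  proof (induction k)
    case (Suc k)
    have "dist (u n) (u (n + Suc k)) \<le> dist (u n) (u (n + k)) + dist (u (n + k)) (u (Suc (n + k)))"
      by (simp add: dist_triangle)
    also have "\<dots> \<le> (e / 2 ^ n - e / 2 ^ (n + k)) + e / 2 ^ Suc (n + k)"
      by (intro add_mono Suc step)
    also have "\<dots> = e / 2 ^ n - e / 2 ^ (n + Suc k)" by simp
    finally show ?case .
  qed simp
  have bnd: "dist (u n) (u (n + k)) \<le> e / 2 ^ n" for n k
  proof -
    have "0 \<le> e / 2 ^ (n + k)" using \<open>e > 0\<close> by simp
    then show ?thesis using tele[of n k] by linarith
  qed
  have "Cauchy u"
  proof (rule metric_CauchyI)
    fix d :: real assume "d > 0"
    have "(\<lambda>n. e / 2 ^ n) \<longlonglongrightarrow> 0" by real_asymp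
    then have "\<forall>\<^sub>F n in sequentially. e / 2 ^ n < d / 2"
      by (rule order_tendstoD(2)) (use \<open>d > 0\<close> in simp)
    then obtain N where N: "e / 2 ^ N < d / 2"
      unfolding eventually_sequentially by blast
    have "dist (u N) (u n) < d / 2" if "n \<ge> N" for n
    proof -
      have "dist (u N) (u n) \<le> e / 2 ^ N" using bnd[of N "n - N"] that by simp
      with N show ?thesis by linarith
    qed
    then show "\<exists>M. \<forall>m\<ge>M. \<forall>n\<ge>M. dist (u m) (u n) < d"
      by (meson dist_commute_lessI dist_triangle_half_r)
  qed
  then obtain l where l: "u \<longlonglongrightarrow> l" using Cauchy_convergent convergent_def by blast
  have "dist (u 0) l \<le> e"
    by (rule LIMSEQ_le_const2[OF tendsto_dist[OF tendsto_const l]]) (use bnd[of 0] in auto)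
  with l show thesis by (rule that)
qed

text \<open>
  Start from \<open>c = e\<close>, \<open>v = 0\<close> and shrink with steps \<open>e / 2 ^ Suc n\<close>, whose sum is \<open>e\<close>; this is where
  the bounds on \<open>c\<close> and \<open>v\<close> come from.  The point common to all the shrinking sets is a
  \<open>t n\<close>-minimiser at every stage, and \<open>t n\<close> tends to zero.
\<close>

proposition tilted_minimum_exists:
  fixes g :: "'x::{real_inner, complete_space} \<Rightarrow> real"
  assumes "D \<noteq> {}" and epi: "closed {(x, r). x \<in> D \<and> g x \<le> r}"
    and bound: "\<forall>x\<in>D. b \<le> g x" and "e > 0"
  obtains c v p where "e \<le> c" "c \<le> 2 * e" "norm v \<le> e"
    and "p \<in> D" "\<And>y. y \<in> D \<Longrightarrow> tilt g c v p \<le> tilt g c v y"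
proof -
  let ?d = "\<lambda>n. e / 2 ^ Suc n"
  have dpos: "?d n > 0" for n using \<open>e > 0\<close> by simp
  \<comment> \<open>A state of the iteration is a triple \<open>(c, v, t)\<close> of coefficient, vector and tolerance.\<close>
  define S where "S s = near_min D (tilt g (fst s) (fst (snd s))) (snd (snd s))"
    for s :: "real \<times> 'x \<times> real"
  define P where "P n s \<longleftrightarrow> e \<le> fst s \<and> 0 < snd (snd s) \<and> (n = 0 \<longrightarrow> s = (e, 0, 1))"
    for n :: nat and s :: "real \<times> 'x \<times> real"
  define Q where "Q n s s' \<longleftrightarrow> dist (fst s) (fst s') \<le> ?d n
      \<and> dist (fst (snd s)) (fst (snd s')) \<le> ?d n \<and> snd (snd s') \<le> ?d n
      \<and> S s' \<subseteq> S s \<and> (\<forall>x\<in>S s'. \<forall>y\<in>S s'. dist x y \<le> ?d n)"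
    for n and s s' :: "real \<times> 'x \<times> real"
  have "\<exists>f. \<forall>n. P n (f n) \<and> Q n (f n) (f (Suc n))"
  proof (rule dependent_nat_choice)
    show "\<exists>s. P 0 s" using \<open>e > 0\<close> by (auto simp: P_def)
    fix s n assume s: "P n s"
    then have "fst s > 0" "snd (snd s) > 0" using \<open>e > 0\<close> by (auto simp: P_def)
    from shrink_near_min[OF \<open>D \<noteq> {}\<close> bound this dpos[of n], of "fst (snd s)"]
    obtain c v t where "fst s \<le> c" "dist (fst s) c \<le> ?d n" "dist (fst (snd s)) v \<le> ?d n"
      "0 < t" "t \<le> ?d n" "S (c, v, t) \<subseteq> S s"
      "\<forall>x\<in>S (c, v, t). \<forall>y\<in>S (c, v, t). dist x y \<le> ?d n"
      unfolding S_def fst_conv snd_conv by blast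
    then have "P (Suc n) (c, v, t) \<and> Q n s (c, v, t)"
      using s unfolding P_def Q_def fst_conv snd_conv by (intro conjI) (blast | linarith | simp)+
    then show "\<exists>s'. P (Suc n) s' \<and> Q n s s'" by blast
  qed
  then obtain f where fP: "\<And>n. P n (f n)" and fQ: "\<And>n. Q n (f n) (f (Suc n))" by blast
  define c where "c n = fst (f n)" for n
  define v where "v n = fst (snd (f n))" for n
  define t where "t n = snd (snd (f n))" for n
  define N where "N n = near_min D (tilt g (c n) (v n)) (t n)" for n
  have init: "c 0 = e" "v 0 = 0" using fP[of 0] by (simp_all add: P_def c_def v_def)
  have pos: "e \<le> c n" "t n > 0" for n using fP[of n] by (simp_all add: P_def c_def t_def)
  have step: "dist (c n) (c (Suc n)) \<le> ?d n" "dist (v n) (v (Suc n)) \<le> ?d n" "t (Suc n) \<le> ?d n"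
      "N (Suc n) \<subseteq> N n" "\<And>x y. x \<in> N (Suc n) \<Longrightarrow> y \<in> N (Suc n) \<Longrightarrow> dist x y \<le> ?d n" for n
    using fQ[of n] unfolding Q_def S_def c_def v_def t_def N_def by blast+
  have d0: "?d \<longlonglongrightarrow> 0" by real_asymp
  obtain c' where c': "c \<longlonglongrightarrow> c'" "dist (c 0) c' \<le> e"
    using geometric_steps_converge[OF step(1) \<open>e > 0\<close>] .
  obtain v' where v': "v \<longlonglongrightarrow> v'" "dist (v 0) v' \<le> e"
    using geometric_steps_converge[OF step(2) \<open>e > 0\<close>] .
  have "(\<lambda>n. t (Suc n)) \<longlonglongrightarrow> 0"
    by (rule tendsto_sandwich[OF _ _ tendsto_const d0]) (use step(3) pos(2) in \<open>auto simp: less_imp_le\<close>)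
  then have t0: "t \<longlonglongrightarrow> 0" by (rule LIMSEQ_imp_Suc)
  obtain p where p: "\<And>n. p \<in> N n"
  proof (rule decreasing_closed_nest[of N])
    show "closed (N n)" for n
      unfolding N_def by (rule closed_near_min_tilt[OF epi \<open>D \<noteq> {}\<close>])
    show "N n \<noteq> {}" for n
    proof -
      have "c n > 0" using pos(1)[of n] \<open>e > 0\<close> by simp
      then show ?thesis unfolding N_def
        using bound \<open>D \<noteq> {}\<close> pos(2)
        by (intro near_min_nonempty[where b = "b - (norm (v n))\<^sup>2 / c n"] ballI tilt_lower_bound) auto
    qed
    show "N n \<subseteq> N m" if "m \<le> n" for m n
      using lift_Suc_antimono_le[of N, OF step(4) that] .
    show "\<exists>n. \<forall>x\<in>N n. \<forall>y\<in>N n. dist x y < r" if "r > 0" for r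
    proof -
      obtain n where "?d n < r"
        using order_tendstoD(2)[OF d0 \<open>r > 0\<close>] unfolding eventually_sequentially by blast
      then show ?thesis using step(5)[of _ n] by (intro exI[of _ "Suc n"]) force
    qed
  qed blast
  show thesis
  proof (rule that)
    show "e \<le> c'" by (rule LIMSEQ_le_const[OF c'(1)]) (use pos in auto)
    show "c' \<le> 2 * e" "norm v' \<le> e" using c'(2) v'(2) by (auto simp: init dist_norm)
    show "p \<in> D" using p[of 0] by (simp add: N_def near_min_def)
    fix y assume "y \<in> D"
    have lim: "(\<lambda>n. tilt g (c n) (v n) x) \<longlonglongrightarrow> tilt g c' v' x" for x
      unfolding tilt_def by (intro tendsto_intros c' v')
    have "(\<lambda>n. tilt g (c n) (v n) y + t n) \<longlonglongrightarrow> tilt g c' v' y + 0"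
      by (intro tendsto_add lim t0)
    moreover have "tilt g (c n) (v n) p \<le> tilt g (c n) (v n) y + t n" for n
      using p[of n] \<open>y \<in> D\<close> by (simp add: N_def near_min_def)
    ultimately show "tilt g c' v' p \<le> tilt g c' v' y"
      using LIMSEQ_le[OF lim] by force
  qed
qed

section \<open>Subgradients that are large on a bounded set\<close>

text \<open>
  The epigraph of a supremum is the intersection of the epigraphs, and members of \<open>Phi_lsc\<close> are
  continuous.
\<close>

lemma closed_epigraph_Phi_lsc_convex:
  assumes "Phi_lsc_convex f"
  shows "closed {(x, r). f x \<le> ereal r}"
proof -
  have "continuous_on UNIV (\<lambda>z::'a \<times> real. \<phi> (fst z))" if phi: "\<phi> \<in> Phi_lsc" for \<phi>
  proof -
    from phi obtain k l d where l: "bounded_linear l" and eq: "\<phi> = (\<lambda>x. - k * (norm x)\<^sup>2 + l x + d)"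
      by (auto simp: Phi_lsc_def)
    show ?thesis unfolding eq
      by (intro continuous_intros bounded_linear.continuous_on[OF l])
  qed
  then have "closed {z::'a \<times> real. \<phi> (fst z) \<le> snd z}" if "\<phi> \<in> supp_lsc f" for \<phi>
    using that by (intro closed_Collect_le continuous_intros) (auto simp: supp_lsc_def)
  moreover have "{(x, r). f x \<le> ereal r} = (\<Inter>\<phi>\<in>supp_lsc f. {z. \<phi> (fst z) \<le> snd z})"
  proof -
    have "f x \<le> ereal r \<longleftrightarrow> (\<forall>\<phi>\<in>supp_lsc f. \<phi> x \<le> r)" for x r
    proof -
      have "f x = (SUP \<phi>\<in>supp_lsc f. ereal (\<phi> x))"
        using assms unfolding Phi_lsc_convex_def by blast
      then show ?thesis by (simp add: SUP_le_iff)
    qed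
    then show ?thesis by auto
  qed
  ultimately show ?thesis by auto
qed

text \<open>
  The negative of a small tilt, raised by the minimum value of the tilted function, is a subgradient
  at the minimiser, and a small tilt cannot pull it far below the lower bound \<open>b\<close> on a bounded set.
\<close>

lemma exists_large_subgradient:
  fixes f :: "'x::{real_inner, complete_space} \<Rightarrow> ereal"
  assumes "proper_fun f" "Phi_lsc_convex f" and bound: "\<And>x. ereal b \<le> f x"
    and "\<alpha> < b" "bounded Z"
  obtains p \<phi> where "p \<in> eff_dom f" "\<phi> \<in> subdiff_lsc f p" "\<And>z. z \<in> Z \<Longrightarrow> \<alpha> \<le> \<phi> z"
proof -
  define g where "g x = real_of_ereal (f x)" for x
  have fg: "f x = ereal (g x)" if "x \<in> eff_dom f" for x
    using that bound[of x] by (cases "f x") (auto simp: g_def eff_dom_def)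
  obtain R where R: "R > 0" "\<And>z. z \<in> Z \<Longrightarrow> norm z \<le> R"
    using \<open>bounded Z\<close> unfolding bounded_pos by blast
  \<comment> \<open>On \<open>Z\<close> the subgradient loses at most \<open>e + 2 e R\<^sup>2 + 2 e R \<le> 2 e (1 + R)\<^sup>2\<close> compared to \<open>b\<close>.\<close>
  define e where "e = (b - \<alpha>) / (2 * (1 + R)\<^sup>2)"
  have e: "e > 0" "2 * e * (1 + R)\<^sup>2 = b - \<alpha>"
    using \<open>\<alpha> < b\<close> \<open>R > 0\<close> by (auto simp: e_def)
  have "{(x, r). x \<in> eff_dom f \<and> g x \<le> r} = {(x, r). f x \<le> ereal r}"
  proof -
    have "x \<in> eff_dom f \<and> g x \<le> r \<longleftrightarrow> f x \<le> ereal r" for x r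
    proof (cases "x \<in> eff_dom f")
      case True
      then show ?thesis using fg by simp
    next
      case False
      then show ?thesis by (simp add: eff_dom_def)
    qed
    then show ?thesis by blast
  qed
  then have epi: "closed {(x, r). x \<in> eff_dom f \<and> g x \<le> r}"
    using closed_epigraph_Phi_lsc_convex[OF assms(2)] by simp
  have bg: "\<forall>x\<in>eff_dom f. b \<le> g x" using bound fg by (metis ereal_less_eq(3))
  obtain c v p where cv: "e \<le> c" "c \<le> 2 * e" "norm v \<le> e" and p: "p \<in> eff_dom f"
    and min: "\<And>y. y \<in> eff_dom f \<Longrightarrow> tilt g c v p \<le> tilt g c v y"
    using tilted_minimum_exists[OF assms(1)[unfolded proper_fun_def] epi bg \<open>e > 0\<close>] by blast
  define \<phi> where "\<phi> x = - c * (norm x)\<^sup>2 + 2 * (v \<bullet> x) + tilt g c v p" for x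
  have "\<phi> \<in> Phi_lsc"
    unfolding Phi_lsc_def mem_Collect_eq
    by (rule exI[of _ c], rule exI[of _ "\<lambda>x. 2 * (v \<bullet> x)"], rule exI[of _ "tilt g c v p"])
      (use cv e in \<open>auto simp: \<phi>_def intro!: bounded_linear_const_mult bounded_linear_inner_right\<close>)
  moreover have "ereal (\<phi> x) \<le> f x" for x
  proof (cases "x \<in> eff_dom f")
    case True
    then show ?thesis using min[OF True] fg[OF True] by (simp add: \<phi>_def tilt_def)
  qed (simp add: eff_dom_def)
  moreover have "ereal (\<phi> p) = f p" using fg[OF p] by (simp add: \<phi>_def tilt_def)
  ultimately have "\<phi> \<in> subdiff_lsc f p" by (simp add: subdiff_lsc_def supp_lsc_def)
  moreover have "\<alpha> \<le> \<phi> z" if "z \<in> Z" for z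
  proof -
    have "b - (norm v)\<^sup>2 / c \<le> tilt g c v p"
      using cv e by (intro tilt_lower_bound bspec[OF bg p]) auto
    moreover have "(norm v)\<^sup>2 / c \<le> e\<^sup>2 / e"
      using cv e by (intro frac_le power_mono) auto
    moreover have "c * (norm z)\<^sup>2 \<le> 2 * e * R\<^sup>2"
      using cv e R that by (intro mult_mono power_mono) auto
    moreover have "- (v \<bullet> z) \<le> e * R"
    proof -
      have "\<bar>v \<bullet> z\<bar> \<le> norm v * norm z" by (rule Cauchy_Schwarz_ineq2)
      also have "\<dots> \<le> e * R" using cv e R that by (intro mult_mono) auto
      finally show ?thesis by simp
    qed
    moreover have "b - \<alpha> = 2 * e + 4 * (e * R) + 2 * e * R\<^sup>2"
      using e(2) by (simp add: power2_eq_square algebra_simps)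
    moreover have "e\<^sup>2 / e = e" "e * R > 0" using e R by (simp_all add: power2_eq_square)
    ultimately show ?thesis using \<open>e > 0\<close> by (simp add: \<phi>_def)
  qed
  ultimately show thesis using p that by blast
qed

theorem theorem6p3:
  fixes a :: "'x::{real_inner, complete_space} \<Rightarrow> 'y::real_vector \<Rightarrow> ereal"
  assumes not_MInf: "\<And>x y. a x y \<noteq> -\<infinity>"
    and proper: "\<And>y. proper_fun (\<lambda>x. a x y)"
    and convex: "\<And>y. Phi_lsc_convex (\<lambda>x. a x y)"
    and minimax: "(SUP y. INF x. a x y) = (INF x. SUP y. a x y)"
  shows "\<forall>\<alpha>::real. ereal \<alpha> < (INF x. SUP y. a x y) \<longrightarrow>
           (\<forall>Z. bounded Z \<longrightarrow>
             (\<exists>y1 y2. \<exists>x1 \<in> eff_dom (\<lambda>x. a x y1). \<exists>x2 \<in> eff_dom (\<lambda>x. a x y2).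
              \<exists>\<phi>1 \<in> subdiff_lsc (\<lambda>x. a x y1) x1. \<exists>\<phi>2 \<in> subdiff_lsc (\<lambda>x. a x y2) x2.
                intersection_property \<phi>1 \<phi>2 Z \<alpha>))"
proof (intro allI impI)
  fix \<alpha> :: real and Z :: "'x set"
  assume "ereal \<alpha> < (INF x. SUP y. a x y)" and Z: "bounded Z"
  then obtain y where "ereal \<alpha> < (INF x. a x y)"
    unfolding minimax[symmetric] by (auto simp: less_SUP_iff)
  then obtain b where b: "\<alpha> < b" "ereal b < (INF x. a x y)"
    using ereal_dense2 less_ereal.simps(1) by blast
  have "ereal b \<le> a x y" for x
    using b(2) by (meson INF_lower UNIV_I less_imp_le order_trans)
  then obtain p \<phi> where "p \<in> eff_dom (\<lambda>x. a x y)" "\<phi> \<in> subdiff_lsc (\<lambda>x. a x y) p"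
    and "\<And>z. z \<in> Z \<Longrightarrow> \<alpha> \<le> \<phi> z"
    using exists_large_subgradient[OF proper[of y] convex[of y] _ b(1) Z] by blast
  moreover from this(3) have "intersection_property \<phi> \<phi> Z \<alpha>"
    by (force simp: intersection_property_def)
  ultimately show "\<exists>y1 y2. \<exists>x1 \<in> eff_dom (\<lambda>x. a x y1). \<exists>x2 \<in> eff_dom (\<lambda>x. a x y2).
      \<exists>\<phi>1 \<in> subdiff_lsc (\<lambda>x. a x y1) x1. \<exists>\<phi>2 \<in> subdiff_lsc (\<lambda>x. a x y2) x2.
        intersection_property \<phi>1 \<phi>2 Z \<alpha>"
    by blast
qed

end
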